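(* Let $k$ be a field and let $n\ge 5$ be an integer. Let $\mathcal{Q}_{(n,4,0)}\subset k[x_0,x_1,x_2,x_3]$ be the defining ideal of the numerical semigroup $\mathfrak{S}_{(n,4,0)}=\langle n^2+2n,\; n^2+2n+1,\; n^2+3n+1,\; n^2+3n+2\rangle$. Put $$A_1'=\{x_2^{(n+1)-\mu}x_3^{\mu}-x_0^{(n+1)-\mu}x_1^{\mu+1} \mid 1\le \mu\le n-1\},$$ $$A_2=\{x_1^{(n+1)-t}x_3^{t}-x_0^{n-t}x_2^{t+1}\mid 0\le t\le n\},$$ $$g_1=x_0^{n+1}-x_3^{n},\qquad g_2=x_1x_2-x_0x_3 .$$ Then $A_1'\cup A_2\cup\{g_1,g_2\}$ is a minimal generating set for the ideal $\mathcal{Q}_{(n,4,0)}$. Hence $\mu(\mathcal{Q}_{(n,4,0)})=2(n+1)$.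
   Context: For a numerical semigroup $\langle m_0,m_1,m_2,m_3\rangle$ with generators listed in increasing order, its defining ideal is the kernel of the $k$-algebra homomorphism $k[x_0,x_1,x_2,x_3]\to k[t]$, $x_i\mapsto t^{m_i}$; here $m_0=n^2+2n$, $m_1=n^2+2n+1$, $m_2=n^2+3n+1$, $m_3=n^2+3n+2$. This ideal is homogeneous for the grading $\deg x_i=m_i$, and $\mu(\cdot)$ denotes the minimal number of generators, i.e. the common cardinality of its minimal homogeneous generating sets. *)

theory Defs
  imports "HOL-Library.Poly_Mapping" "HOL-Computational_Algebra.Polynomial"
begin

text \<open>
  For a finite type \<open>'v\<close> of variables, the polynomial ring over \<open>'k\<close> is the type
  \<open>('v \<Rightarrow>\<^sub>0 nat) \<Rightarrow>\<^sub>0 'k\<close> of finitely supported maps from exponent vectors to coefficients,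
  with the convolution product of \<open>HOL-Library.Poly_Mapping\<close>.
\<close>

datatype var = X0 | X1 | X2 | X3

lemma UNIV_var: "UNIV = {X0, X1, X2, X3}"
  by (auto intro: var.exhaust)

instance var :: finite
  by standard (simp add: UNIV_var)

type_synonym ('v, 'k) mpol = "('v \<Rightarrow>\<^sub>0 nat) \<Rightarrow>\<^sub>0 'k"

definition Var :: "'v \<Rightarrow> ('v, 'k::comm_ring_1) mpol" where
  "Var i = Poly_Mapping.single (Poly_Mapping.single i 1) 1"

abbreviation x0 :: "(var, 'k::comm_ring_1) mpol" where "x0 \<equiv> Var X0"
abbreviation x1 :: "(var, 'k::comm_ring_1) mpol" where "x1 \<equiv> Var X1"
abbreviation x2 :: "(var, 'k::comm_ring_1) mpol" where "x2 \<equiv> Var X2"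
abbreviation x3 :: "(var, 'k::comm_ring_1) mpol" where "x3 \<equiv> Var X3"

text \<open>
  An ideal of a commutative ring is a submodule of the ring regarded as a module over itself,
  so the ideal generated by a set is its span.
\<close>

lemma module_times: "module ((*) :: 'r::comm_ring_1 \<Rightarrow> 'r \<Rightarrow> 'r)"
  by unfold_locales (simp_all add: algebra_simps)

definition ideal_gen :: "'r::comm_ring_1 set \<Rightarrow> 'r set" where
  "ideal_gen S = module.span (*) S"

definition minimal_generating_set :: "'r::comm_ring_1 set \<Rightarrow> 'r set \<Rightarrow> bool" where
  "minimal_generating_set I S \<longleftrightarrow> ideal_gen S = I \<and> (\<forall>T. T \<subset> S \<longrightarrow> ideal_gen T \<noteq> I)"

text \<open>
  The least size of a finite generating set, homogeneous or not. As \<open>LEAST\<close> is unspecified when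
  there is no such set, this is meaningful only for finitely generated ideals.
\<close>

definition min_num_generators :: "'r::comm_ring_1 set \<Rightarrow> nat" where
  "min_num_generators I = (LEAST c. \<exists>S. finite S \<and> card S = c \<and> ideal_gen S = I)"

definition weight :: "('v::finite \<Rightarrow> nat) \<Rightarrow> ('v \<Rightarrow>\<^sub>0 nat) \<Rightarrow> nat" where
  "weight m a = (\<Sum>i\<in>UNIV. m i * Poly_Mapping.lookup a i)"

text \<open>The zero polynomial is homogeneous of every degree.\<close>

definition homogeneous :: "('v::finite \<Rightarrow> nat) \<Rightarrow> ('v, 'k::comm_ring_1) mpol \<Rightarrow> bool" where
  "homogeneous m p \<longleftrightarrow> (\<exists>d. \<forall>a\<in>Poly_Mapping.keys p. weight m a = d)"

definition minimal_homogeneous_generating_set ::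
    "('v::finite \<Rightarrow> nat) \<Rightarrow> ('v, 'k::comm_ring_1) mpol set \<Rightarrow> ('v, 'k) mpol set \<Rightarrow> bool" where
  "minimal_homogeneous_generating_set m I S \<longleftrightarrow>
     minimal_generating_set I S \<and> (\<forall>p\<in>S. homogeneous m p)"

text \<open>
  The \<open>'k\<close>-algebra homomorphism from the polynomial ring to \<open>'k[t]\<close> that sends the variable
  \<open>i\<close> to \<open>t\<close> to the power \<open>m i\<close>; note that \<open>monom 1 d\<close> is the univariate monomial
  of exponent \<open>d\<close>.
\<close>

definition power_subst :: "('v::finite \<Rightarrow> nat) \<Rightarrow> ('v, 'k::comm_ring_1) mpol \<Rightarrow> 'k poly" where
  "power_subst m p =
     (\<Sum>a\<in>Poly_Mapping.keys p.
        smult (Poly_Mapping.lookup p a) (\<Prod>i\<in>UNIV. monom 1 (m i) ^ Poly_Mapping.lookup a i))"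

definition defining_ideal :: "('v::finite \<Rightarrow> nat) \<Rightarrow> ('v, 'k::comm_ring_1) mpol set" where
  "defining_ideal m = {p. power_subst m p = 0}"

fun gen4 :: "nat \<Rightarrow> var \<Rightarrow> nat" where
  "gen4 n X0 = n^2 + 2*n"
| "gen4 n X1 = n^2 + 2*n + 1"
| "gen4 n X2 = n^2 + 3*n + 1"
| "gen4 n X3 = n^2 + 3*n + 2"

definition Q4 :: "nat \<Rightarrow> (var, 'k::field) mpol set" where
  "Q4 n = defining_ideal (gen4 n)"

definition A1' :: "nat \<Rightarrow> (var, 'k::field) mpol set" where
  "A1' n = {x2^((n+1)-\<mu>) * x3^\<mu> - x0^((n+1)-\<mu>) * x1^(\<mu>+1) | \<mu>. 1 \<le> \<mu> \<and> \<mu> \<le> n-1}"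

definition A2 :: "nat \<Rightarrow> (var, 'k::field) mpol set" where
  "A2 n = {x1^((n+1)-t) * x3^t - x0^(n-t) * x2^(t+1) | t. 0 \<le> t \<and> t \<le> n}"

definition g1 :: "nat \<Rightarrow> (var, 'k::field) mpol" where
  "g1 n = x0^(n+1) - x3^n"

definition g2 :: "(var, 'k::field) mpol" where
  "g2 = x1 * x2 - x0 * x3"

end

theory Submission
  imports Defs
begin

text \<open>
  Each of the listed generators is homogeneous and contains a monomial that shares no variable
  with any other monomial of the same weight. For such an isolated monomial \<open>a\<close> and \<open>q\<close> in the
  ideal, the coefficient of \<open>r * q\<close> at \<open>a\<close> is the constant coefficient of \<open>r\<close> times that of \<open>q\<close>.
  The isolated monomials have pairwise distinct weights, so reading off their coefficients gives
  independent functionals modulo the maximal ideal, and every generating set needs at least as many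
  elements. A homogeneous element with nonzero coefficient at \<open>a\<close> recovers, modulo generators of
  smaller weight, the generator containing \<open>a\<close>; this gives the size of the minimal homogeneous
  generating sets.

  That the binomials generate follows by rewriting. A monomial of degree \<open>D\<close> has weight
  \<open>D * (n * (n + 2)) + B + (n + 1) * C\<close>, where \<open>B\<close> is its degree in \<open>x1, x3\<close> and \<open>C\<close> its degree
  in \<open>x2, x3\<close>. Reduced monomials have \<open>B, C \<le> n\<close>, not both equal to \<open>n\<close>, so the weight
  determines \<open>D\<close>, \<open>B\<close> and \<open>C\<close>, hence the reduced monomial.
\<close>

subsection \<open>Fibre sums and the defining ideal\<close>

interpretation ideal: module "(*) :: 'r::comm_ring_1 \<Rightarrow> 'r \<Rightarrow> 'r"
  by (rule module_times)

lemma ideal_gen_base: "p \<in> S \<Longrightarrow> p \<in> ideal_gen S"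
  by (simp add: ideal_gen_def ideal.span_base)

lemma ideal_gen_times: "p \<in> ideal_gen S \<Longrightarrow> r * p \<in> ideal_gen S"
  by (simp add: ideal_gen_def ideal.span_scale)

lemma ideal_gen_add: "p \<in> ideal_gen S \<Longrightarrow> q \<in> ideal_gen S \<Longrightarrow> p + q \<in> ideal_gen S"
  by (simp add: ideal_gen_def ideal.span_add)

lemma ideal_gen_diff: "p \<in> ideal_gen S \<Longrightarrow> q \<in> ideal_gen S \<Longrightarrow> p - q \<in> ideal_gen S"
  by (simp add: ideal_gen_def ideal.span_diff)

lemma ideal_gen_sum: "(\<And>x. x \<in> A \<Longrightarrow> f x \<in> ideal_gen S) \<Longrightarrow> sum f A \<in> ideal_gen S"
  by (simp add: ideal_gen_def ideal.span_sum)

lemma ideal_gen_minimal: "S \<subseteq> ideal_gen T \<Longrightarrow> ideal_gen S \<subseteq> ideal_gen T"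
  by (simp add: ideal_gen_def ideal.span_minimal)

lemma lookup_single_times:
  fixes q :: "('v, 'k::comm_ring_1) mpol"
  shows "Poly_Mapping.lookup (Poly_Mapping.single b c * q) (b + k) = c * Poly_Mapping.lookup q k"
  by (simp add: lookup_mult lookup_single when_mult)

lemma keys_single_times:
  fixes q :: "('v, 'k::comm_ring_1) mpol"
  shows "Poly_Mapping.keys (Poly_Mapping.single b c * q) \<subseteq> (+) b ` Poly_Mapping.keys q"
  using keys_mult[of "Poly_Mapping.single b c" q] by (auto split: if_splits)

lemma sum_single_lookup:
  "(\<Sum>a\<in>Poly_Mapping.keys p. Poly_Mapping.single a (Poly_Mapping.lookup p a)) = p"
  by (rule poly_mapping_eqI) (auto simp: lookup_sum lookup_single when_def in_keys_iff)

lemma times_eq_sum: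
  fixes r q :: "('v, 'k::comm_ring_1) mpol"
  shows "r * q = (\<Sum>b\<in>Poly_Mapping.keys r. Poly_Mapping.single b (Poly_Mapping.lookup r b) * q)"
  by (simp only: sum_single_lookup flip: sum_distrib_right)

lemma weight_add: "weight m (a + b) = weight m a + weight m b"
  by (simp add: weight_def lookup_add algebra_simps sum.distrib)

text \<open>The coefficient of t^w in the image of \<open>p\<close>, by
  \<open>coeff_power_subst\<close>. Membership in the ideal thus becomes additive bookkeeping on
  exponent vectors.\<close>

definition fibre_sum :: "('v::finite \<Rightarrow> nat) \<Rightarrow> ('v, 'k::comm_ring_1) mpol \<Rightarrow> nat \<Rightarrow> 'k" where
  "fibre_sum m p w = (\<Sum>a | a \<in> Poly_Mapping.keys p \<and> weight m a = w. Poly_Mapping.lookup p a)"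

lemma fibre_sum_superset:
  assumes "finite A" "Poly_Mapping.keys p \<subseteq> A"
  shows "fibre_sum m p w = (\<Sum>a | a \<in> A \<and> weight m a = w. Poly_Mapping.lookup p a)"
  unfolding fibre_sum_def
  by (rule sum.mono_neutral_left) (use assms in \<open>auto simp: in_keys_iff\<close>)

lemma fibre_sum_zero: "fibre_sum m 0 w = 0"
  by (simp add: fibre_sum_def)

lemma fibre_sum_add: "fibre_sum m (p + q) w = fibre_sum m p w + fibre_sum m q w"
proof -
  let ?A = "Poly_Mapping.keys p \<union> Poly_Mapping.keys q"
  have "Poly_Mapping.keys (p + q) \<subseteq> ?A" by (rule keys_add)
  then show ?thesis
    by (simp add: fibre_sum_superset[of ?A] lookup_add sum.distrib)
qed

lemma fibre_sum_single:
  "fibre_sum m (Poly_Mapping.single a c) w = (if weight m a = w then c else 0)"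
  by (subst fibre_sum_superset[of "{a}"]) (auto simp: Collect_conv_if)

text \<open>Multiplication by a monomial translates fibres by a fixed weight. The case distinction
  guards the truncated subtraction \<open>w - weight m b\<close>.\<close>

lemma fibre_sum_single_times:
  "fibre_sum m (Poly_Mapping.single b c * q) w =
     (if weight m b \<le> w then c * fibre_sum m q (w - weight m b) else 0)"
proof -
  have "fibre_sum m (Poly_Mapping.single b c * q) w =
      (\<Sum>a | a \<in> (+) b ` Poly_Mapping.keys q \<and> weight m a = w.
        Poly_Mapping.lookup (Poly_Mapping.single b c * q) a)"
    by (rule fibre_sum_superset) (simp_all add: keys_single_times)
  also have "{a. a \<in> (+) b ` Poly_Mapping.keys q \<and> weight m a = w} =
      (+) b ` {a. a \<in> Poly_Mapping.keys q \<and> weight m b + weight m a = w}"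
    by (auto simp: weight_add)
  also have "(\<Sum>a\<in>\<dots>. Poly_Mapping.lookup (Poly_Mapping.single b c * q) a) =
      (\<Sum>a | a \<in> Poly_Mapping.keys q \<and> weight m b + weight m a = w. c * Poly_Mapping.lookup q a)"
    by (subst sum.reindex) (auto simp: lookup_single_times)
  also have "\<dots> = (if weight m b \<le> w then c * fibre_sum m q (w - weight m b) else 0)"
  proof (cases "weight m b \<le> w")
    case True
    then have "{a. a \<in> Poly_Mapping.keys q \<and> weight m b + weight m a = w} =
        {a. a \<in> Poly_Mapping.keys q \<and> weight m a = w - weight m b}" by auto
    then show ?thesis using True by (simp add: fibre_sum_def sum_distrib_left)
  next
    case False
    then have "{a. a \<in> Poly_Mapping.keys q \<and> weight m b + weight m a = w} = {}" by auto
    then show ?thesis using False by (simp only: sum.empty if_False)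
  qed
  finally show ?thesis .
qed

lemma coeff_power_subst: "coeff (power_subst m p) w = fibre_sum m p w"
proof -
  have "(\<Prod>i\<in>UNIV. (monom 1 (m i) :: 'a poly) ^ Poly_Mapping.lookup a i) = monom 1 (weight m a)" for a
  proof -
    have "(\<Prod>i\<in>A. (monom 1 (m i) :: 'a poly) ^ Poly_Mapping.lookup a i) =
        monom 1 (\<Sum>i\<in>A. m i * Poly_Mapping.lookup a i)" if "finite A" for A
      using that by induction (simp_all add: monom_power mult_monom)
    then show ?thesis by (simp add: weight_def)
  qed
  then have "coeff (power_subst m p) w =
      (\<Sum>a\<in>Poly_Mapping.keys p. if weight m a = w then Poly_Mapping.lookup p a else 0)"
    by (simp add: power_subst_def coeff_sum smult_monom)
  then show ?thesis
    by (simp add: fibre_sum_def sum.inter_filter)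
qed

lemma mem_defining_ideal_iff: "p \<in> defining_ideal m \<longleftrightarrow> (\<forall>w. fibre_sum m p w = 0)"
  by (simp add: defining_ideal_def poly_eq_iff coeff_power_subst)

lemma subspace_defining_ideal:
  "ideal.subspace (defining_ideal m :: ('v::finite, 'k::comm_ring_1) mpol set)"
proof (rule ideal.subspaceI)
  show "0 \<in> (defining_ideal m :: ('v, 'k) mpol set)"
    by (simp add: mem_defining_ideal_iff fibre_sum_zero)
  show add: "p + q \<in> defining_ideal m"
    if "p \<in> defining_ideal m" "q \<in> defining_ideal m" for p q :: "('v, 'k) mpol"
    using that by (simp add: mem_defining_ideal_iff fibre_sum_add)
  show "r * q \<in> defining_ideal m" if "q \<in> defining_ideal m" for r q :: "('v, 'k) mpol"
  proof -
    \<comment> \<open>Split \<open>r\<close> into terms and induct over an arbitrary finite set of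
      exponents, since \<open>r\<close> itself must stay fixed.\<close>
    have "fibre_sum m (\<Sum>b\<in>A. Poly_Mapping.single b (Poly_Mapping.lookup r b) * q) w = 0"
      if "finite A" for A w
      using that \<open>q \<in> defining_ideal m\<close>
      by induction
        (simp_all add: fibre_sum_zero fibre_sum_add fibre_sum_single_times mem_defining_ideal_iff)
    then show ?thesis by (subst times_eq_sum) (simp add: mem_defining_ideal_iff)
  qed
qed

lemma ideal_gen_subset_defining_ideal:
  "S \<subseteq> defining_ideal m \<Longrightarrow> ideal_gen S \<subseteq> defining_ideal m"
  unfolding ideal_gen_def by (rule ideal.span_minimal[OF _ subspace_defining_ideal])

lemma binomial_mem_defining_ideal:
  assumes "weight m a = weight m b"
  shows "Poly_Mapping.single b 1 - Poly_Mapping.single a 1 \<in> (defining_ideal m :: ('v::finite, 'k::comm_ring_1) mpol set)"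
proof -
  have "Poly_Mapping.single b 1 + Poly_Mapping.single a (-1) \<in> (defining_ideal m :: ('v, 'k) mpol set)"
    using assms by (simp add: mem_defining_ideal_iff fibre_sum_add fibre_sum_single)
  then show ?thesis by (simp add: single_uminus)
qed

text \<open>Send every monomial to a chosen representative of its fibre. The image of
  \<open>p\<close> has fibre sums as coefficients and vanishes, so \<open>p\<close> is a combination
  of differences between its monomials and their representatives.\<close>

lemma defining_ideal_subset:
  fixes S :: "('v::finite, 'k::comm_ring_1) mpol set"
  assumes "\<And>a b. weight m a = weight m b \<Longrightarrow>
    Poly_Mapping.single a 1 - Poly_Mapping.single b 1 \<in> ideal_gen S"
  shows "defining_ideal m \<subseteq> ideal_gen S"
proof
  fix p :: "('v, 'k) mpol"
  assume p: "p \<in> defining_ideal m"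
  \<comment> \<open>Arbitrary at weights that no monomial attains; \<open>N\<close> is only
    evaluated at attained ones.\<close>
  define N where "N w = (SOME a :: 'v \<Rightarrow>\<^sub>0 nat. weight m a = w)" for w
  have N: "weight m (N (weight m a)) = weight m a" for a
    unfolding N_def by (rule someI) (rule refl)
  have "(\<Sum>a\<in>Poly_Mapping.keys p. Poly_Mapping.single (N (weight m a)) (Poly_Mapping.lookup p a)) = 0"
  proof (rule poly_mapping_eqI)
    fix c
    have "Poly_Mapping.lookup (\<Sum>a\<in>Poly_Mapping.keys p.
        Poly_Mapping.single (N (weight m a)) (Poly_Mapping.lookup p a)) c =
        (\<Sum>a | a \<in> Poly_Mapping.keys p \<and> N (weight m a) = c. Poly_Mapping.lookup p a)"
      by (simp add: lookup_sum lookup_single when_def sum.inter_filter)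
    also have "\<dots> = 0"
    proof (cases "N (weight m c) = c")
      case True
      then have "N (weight m a) = c \<longleftrightarrow> weight m a = weight m c" for a
        using N by metis
      then show ?thesis
        using p by (simp add: mem_defining_ideal_iff fibre_sum_def)
    next
      case False
      then have "N (weight m a) \<noteq> c" for a using N by metis
      then show ?thesis by simp
    qed
    finally show "Poly_Mapping.lookup (\<Sum>a\<in>Poly_Mapping.keys p.
        Poly_Mapping.single (N (weight m a)) (Poly_Mapping.lookup p a)) c = Poly_Mapping.lookup 0 c"
      by simp
  qed
  then have "p = (\<Sum>a\<in>Poly_Mapping.keys p. Poly_Mapping.single a (Poly_Mapping.lookup p a) -
      Poly_Mapping.single (N (weight m a)) (Poly_Mapping.lookup p a))"
    by (simp add: sum_subtractf sum_single_lookup)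
  also have "\<dots> = (\<Sum>a\<in>Poly_Mapping.keys p. Poly_Mapping.single 0 (Poly_Mapping.lookup p a) *
      (Poly_Mapping.single a 1 - Poly_Mapping.single (N (weight m a)) 1))"
    by (simp add: algebra_simps mult_single)
  also have "\<dots> \<in> ideal_gen S"
    by (intro ideal_gen_sum ideal_gen_times assms) (simp add: N)
  finally show "p \<in> ideal_gen S" .
qed

subsection \<open>Isolated monomials\<close>

text \<open>An isolated vertex of the graph on the fibre of \<open>a\<close> that joins monomials
  with a common variable.\<close>

definition isolated :: "('v::finite \<Rightarrow> nat) \<Rightarrow> ('v \<Rightarrow>\<^sub>0 nat) \<Rightarrow> bool" where
  "isolated m a \<longleftrightarrow>
     (\<forall>c. weight m c = weight m a \<longrightarrow> c \<noteq> a \<longrightarrow> Poly_Mapping.keys c \<inter> Poly_Mapping.keys a = {})"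

text \<open>A proper divisor of an isolated monomial is alone in its fibre, so it does not occur in the ideal.\<close>

lemma lookup_times_isolated:
  fixes r q :: "('v::finite, 'k::comm_ring_1) mpol"
  assumes a: "isolated m a" and q: "q \<in> defining_ideal m"
  shows "Poly_Mapping.lookup (r * q) a = Poly_Mapping.lookup r 0 * Poly_Mapping.lookup q a"
proof -
  have *: "Poly_Mapping.lookup (Poly_Mapping.single b c * q) a =
      (if b = 0 then c * Poly_Mapping.lookup q a else 0)" for b c
  proof (cases "b = 0")
    case True
    then show ?thesis using lookup_single_times[of b c q a] by simp
  next
    case False
    show ?thesis
    proof (cases "\<exists>k. a = b + k")
      case False
      then show ?thesis using \<open>b \<noteq> 0\<close> keys_single_times[of b c q] by (force simp: in_keys_iff)
    next
      case True
      then obtain k where k: "a = b + k" by blast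
      obtain i where "i \<in> Poly_Mapping.keys b"
        using \<open>b \<noteq> 0\<close> by (metis in_keys_iff lookup_zero poly_mapping_eqI)
      then have "i \<in> Poly_Mapping.keys (b + j)" for j
        by (simp add: in_keys_iff lookup_add)
      have "j = k" if "weight m j = weight m k" for j
      proof -
        have "weight m (b + j) = weight m a"
          using that k by (simp add: weight_add)
        then have "b + j = a"
          using a \<open>\<And>j. i \<in> Poly_Mapping.keys (b + j)\<close>[of j] \<open>\<And>j. i \<in> Poly_Mapping.keys (b + j)\<close>[of k] k
          by (auto simp: isolated_def)
        then show ?thesis using k by simp
      qed
      then have "fibre_sum m q (weight m k) = (\<Sum>j | j \<in> Poly_Mapping.keys q \<and> j = k. Poly_Mapping.lookup q j)"
        unfolding fibre_sum_def by (intro sum.cong) auto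
      also have "\<dots> = Poly_Mapping.lookup q k"
        by (cases "k \<in> Poly_Mapping.keys q") (auto simp: in_keys_iff Collect_conv_if)
      finally show ?thesis
        using q \<open>b \<noteq> 0\<close> by (simp add: k lookup_single_times mem_defining_ideal_iff)
    qed
  qed
  show ?thesis
    by (subst times_eq_sum) (auto simp: lookup_sum * in_keys_iff)
qed

section \<open>Binomial generators that each own an isolated monomial\<close>

lemma lookup_map_times:
  fixes c :: "'k::field"
  shows "Poly_Mapping.lookup (Poly_Mapping.map ((*) c) f) i = c * Poly_Mapping.lookup f i"
  by (simp add: map.rep_eq when_def)

lemma vector_space_poly_mapping:
  "vector_space (\<lambda>c::'k::field. Poly_Mapping.map ((*) c) :: ('i \<Rightarrow>\<^sub>0 'k) \<Rightarrow> _)"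
  apply (rule vector_space.intro; rule poly_mapping_eqI)
  apply (unfold lookup_map_times lookup_add)
  apply (simp_all add: distrib_left distrib_right)
  done

text \<open>Assumption \<open>fibre\<close> tolerates more than two monomials in a fibre: any
  monomial other than \<open>a i\<close> need only agree with \<open>b i\<close> modulo generators
  of smaller weight. For the binomials below this extra room is used at
  \<open>Edge n\<close>.\<close>

locale indispensable_generators =
  fixes m :: "'v::finite \<Rightarrow> nat" and I :: "'i set" and a b :: "'i \<Rightarrow> ('v \<Rightarrow>\<^sub>0 nat)"
    and g :: "'i \<Rightarrow> ('v, 'k::field) mpol"
  assumes finite_I: "finite I"
    and g_eq: "i \<in> I \<Longrightarrow> g i = Poly_Mapping.single (b i) 1 - Poly_Mapping.single (a i) 1"
    and a_neq_b: "i \<in> I \<Longrightarrow> a i \<noteq> b i"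
    and weight_b: "i \<in> I \<Longrightarrow> weight m (b i) = weight m (a i)"
    and inj_weight: "inj_on (\<lambda>i. weight m (a i)) I"
    and isolated_a: "i \<in> I \<Longrightarrow> isolated m (a i)"
    and fibre: "i \<in> I \<Longrightarrow> weight m c = weight m (a i) \<Longrightarrow> c \<noteq> a i \<Longrightarrow>
      Poly_Mapping.single c 1 - Poly_Mapping.single (b i) 1
        \<in> ideal_gen (g ` {j \<in> I. weight m (a j) < weight m (a i)})"
    and generates: "ideal_gen (g ` I) = defining_ideal m"
begin

lemma g_mem: "i \<in> I \<Longrightarrow> g i \<in> defining_ideal m"
  using ideal_gen_base[of "g i" "g ` I"] by (simp add: generates)

text \<open>Distinct weights keep \<open>a i\<close> out of every other binomial, so the matrix of
  coefficients is minus the identity.\<close>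

lemma lookup_g:
  assumes "i \<in> I" "j \<in> I"
  shows "Poly_Mapping.lookup (g j) (a i) = (if i = j then - 1 else 0)"
proof (cases "i = j")
  case True
  then show ?thesis
    using assms a_neq_b[of i] by (simp add: g_eq lookup_minus lookup_single)
next
  case False
  then have "weight m (a i) \<noteq> weight m (a j)"
    using assms inj_weight by (auto dest: inj_onD)
  then have "a i \<noteq> a j" "a i \<noteq> b j"
    using weight_b assms by auto
  then show ?thesis
    using False assms by (auto simp: g_eq lookup_minus lookup_single when_def)
qed

lemma inj_g: "inj_on g I"
proof (rule inj_onI)
  fix i j assume "i \<in> I" "j \<in> I" "g i = g j"
  then have "Poly_Mapping.lookup (g j) (a i) = - 1"
    using lookup_g[of i i] by simp
  then show "i = j"
    using lookup_g[of i j] \<open>i \<in> I\<close> \<open>j \<in> I\<close> by (simp split: if_splits)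
qed

text \<open>Otherwise \<open>S\<close> would lie among the elements of the ideal whose coefficient
  at \<open>a i\<close> vanishes. By \<open>lookup_times_isolated\<close> these form an ideal, yet
  it misses \<open>g i\<close>.\<close>

lemma ex_lookup_nonzero:
  fixes S :: "('v, 'k) mpol set"
  assumes i: "i \<in> I" and S: "ideal_gen S = defining_ideal m"
  shows "\<exists>s\<in>S. Poly_Mapping.lookup s (a i) \<noteq> 0"
proof (rule ccontr)
  assume "\<not> ?thesis"
  then have zero: "Poly_Mapping.lookup s (a i) = 0" if "s \<in> S" for s using that by blast
  let ?V = "{p \<in> defining_ideal m :: ('v, 'k) mpol set. Poly_Mapping.lookup p (a i) = 0}"
  have "ideal.subspace ?V"
    using subspace_defining_ideal[of m, where 'k = 'k] isolated_a[OF i]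
    by (auto simp: ideal.subspace_def lookup_add lookup_times_isolated)
  moreover have "S \<subseteq> ?V"
    using zero S ideal_gen_base[of _ S] by auto
  ultimately have "ideal_gen S \<subseteq> ?V"
    unfolding ideal_gen_def by (intro ideal.span_minimal)
  then show False
    using S g_mem[OF i] lookup_g[OF i i] by auto
qed

lemma minimal_generating_set_g: "minimal_generating_set (defining_ideal m) (g ` I)"
  unfolding minimal_generating_set_def
proof (intro conjI allI impI)
  show "ideal_gen (g ` I) = defining_ideal m" by (rule generates)
  fix T assume T: "T \<subset> g ` I"
  then obtain i where i: "i \<in> I" "g i \<notin> T" by blast
  show "ideal_gen T \<noteq> defining_ideal m"
  proof
    assume "ideal_gen T = defining_ideal m"
    from ex_lookup_nonzero[OF i(1) this] obtain s where "s \<in> T" "Poly_Mapping.lookup s (a i) \<noteq> 0"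
      by blast
    then obtain j where "j \<in> I" "s = g j"
      using T by blast
    then show False
      using \<open>s \<in> T\<close> \<open>Poly_Mapping.lookup s (a i) \<noteq> 0\<close> i lookup_g[OF i(1)]
      by (auto split: if_splits)
  qed
qed

text \<open>Collect the coefficients at all \<open>a i\<close> into a vector. On the ideal,
  multiplication by \<open>r\<close> scales this vector by the constant coefficient of
  \<open>r\<close>, so the images of \<open>S\<close> span those of the \<open>g i\<close>, which
  are minus the unit vectors.\<close>

lemma card_le_generating_set:
  fixes S :: "('v, 'k) mpol set"
  assumes "finite S" and S: "ideal_gen S = defining_ideal m"
  shows "card I \<le> card S"
proof -
  let ?scale = "\<lambda>c::'k. Poly_Mapping.map ((*) c) :: ('i \<Rightarrow>\<^sub>0 'k) \<Rightarrow> _"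
  interpret vs: vector_space ?scale
    by (rule vector_space_poly_mapping)
  define \<phi> :: "('v, 'k) mpol \<Rightarrow> ('i \<Rightarrow>\<^sub>0 'k)"
    where "\<phi> p = (\<Sum>i\<in>I. Poly_Mapping.single i (Poly_Mapping.lookup p (a i)))" for p
  have lookup_\<phi>: "Poly_Mapping.lookup (\<phi> p) i = (if i \<in> I then Poly_Mapping.lookup p (a i) else 0)" for p i
    by (simp add: \<phi>_def lookup_sum lookup_single when_def finite_I)
  define u :: "'i \<Rightarrow> ('i \<Rightarrow>\<^sub>0 'k)" where "u j = \<phi> (g j)" for j
  have u: "Poly_Mapping.lookup (u j) i = (if i = j then - 1 else 0)" if "j \<in> I" for i j
    using that by (auto simp: u_def lookup_\<phi> lookup_g)
  have inj_u: "inj_on u I"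
  proof (rule inj_onI)
    fix i j assume "i \<in> I" "j \<in> I" "u i = u j"
    then have "Poly_Mapping.lookup (u j) i = - 1"
      using u[of i i] by simp
    then show "i = j"
      using u[of j i] \<open>j \<in> I\<close> by (simp split: if_splits)
  qed
  have "vs.independent (u ` I)"
  proof (rule vs.independent_if_scalars_zero)
    show "finite (u ` I)" by (simp add: finite_I)
    fix f x assume sum: "(\<Sum>x\<in>u ` I. ?scale (f x) x) = 0" and "x \<in> u ` I"
    then obtain j where j: "j \<in> I" "x = u j" by blast
    have "0 = Poly_Mapping.lookup (\<Sum>x\<in>u ` I. ?scale (f x) x) j" by (simp add: sum)
    also have "\<dots> = (\<Sum>i\<in>I. f (u i) * Poly_Mapping.lookup (u i) j)"
      by (simp add: sum.reindex inj_u lookup_sum lookup_map_times)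
    also have "\<dots> = (\<Sum>i\<in>I. if i = j then - f (u i) else 0)"
      by (rule sum.cong) (auto simp: u)
    also have "\<dots> = - f x" using j finite_I by simp
    finally show "f x = 0" by simp
  qed
  moreover have "u ` I \<subseteq> vs.span (\<phi> ` S)"
  proof -
    \<comment> \<open>The condition of lying in the ideal must be carried along: outside it, \<phi>
      need not turn multiplication by \<open>r\<close> into a scaling.\<close>
    let ?V = "{p \<in> defining_ideal m :: ('v, 'k) mpol set. \<phi> p \<in> vs.span (\<phi> ` S)}"
    have "\<phi> 0 = 0"
      by (rule poly_mapping_eqI) (simp add: lookup_\<phi>)
    moreover have "\<phi> (p + q) = \<phi> p + \<phi> q" for p q
      by (rule poly_mapping_eqI) (simp add: lookup_\<phi> lookup_add)
    moreover have "\<phi> (r * p) = ?scale (Poly_Mapping.lookup r 0) (\<phi> p)" if "p \<in> defining_ideal m" for r p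
      by (rule poly_mapping_eqI) (simp add: that lookup_\<phi> lookup_map_times lookup_times_isolated[OF isolated_a])
    ultimately have "ideal.subspace ?V"
      using subspace_defining_ideal[of m, where 'k = 'k]
      by (auto simp: ideal.subspace_def vs.span_zero vs.span_add vs.span_scale)
    moreover have "S \<subseteq> ?V"
      using S ideal_gen_base[of _ S] by (auto intro: vs.span_base)
    ultimately have "ideal_gen S \<subseteq> ?V"
      unfolding ideal_gen_def by (intro ideal.span_minimal)
    then show ?thesis using S g_mem by (auto simp: u_def)
  qed
  ultimately have "card (u ` I) \<le> card (\<phi> ` S)"
    using vs.independent_span_bound[of "\<phi> ` S" "u ` I"] \<open>finite S\<close> by simp
  also have "\<dots> \<le> card S" by (rule card_image_le[OF \<open>finite S\<close>])
  finally show ?thesis unfolding card_image[OF inj_u] .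
qed

lemma min_num_generators_eq: "min_num_generators (defining_ideal m :: ('v, 'k) mpol set) = card I"
  unfolding min_num_generators_def
proof (rule Least_equality)
  have "finite (g ` I)" "card (g ` I) = card I"
    by (simp_all add: finite_I card_image[OF inj_g])
  then show "\<exists>S :: ('v, 'k) mpol set. finite S \<and> card S = card I \<and> ideal_gen S = defining_ideal m"
    using generates by blast
next
  fix c
  assume "\<exists>S :: ('v, 'k) mpol set. finite S \<and> card S = c \<and> ideal_gen S = defining_ideal m"
  then obtain S :: "('v, 'k) mpol set" where "finite S" "card S = c" "ideal_gen S = defining_ideal m"
    by blast
  with card_le_generating_set[OF this(1,3)] show "card I \<le> c"
    by (simp only:)
qed

text \<open>The coefficients of \<open>s\<close> sum to zero, as all its monomials lie in the fibre
  of \<open>a i\<close>. Hence \<open>s\<close> is a combination of differences with the monomial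
  \<open>b i\<close>: the term at \<open>a i\<close> is a nonzero multiple of \<open>g i\<close>,
  the others come from lower generators by \<open>fibre\<close>.\<close>

lemma g_mem_of_homogeneous:
  assumes i: "i \<in> I" and s: "s \<in> defining_ideal m" "homogeneous m s"
    and nz: "Poly_Mapping.lookup s (a i) \<noteq> 0"
    and sT: "s \<in> ideal_gen T"
    and lower: "\<And>j. j \<in> I \<Longrightarrow> weight m (a j) < weight m (a i) \<Longrightarrow> g j \<in> ideal_gen T"
  shows "g i \<in> ideal_gen T"
proof -
  let ?s = "Poly_Mapping.lookup s"
  from s(2) obtain d where "\<forall>c\<in>Poly_Mapping.keys s. weight m c = d"
    unfolding homogeneous_def by (rule exE)
  note d = bspec[OF this]
  have a: "a i \<in> Poly_Mapping.keys s"
    using nz by (simp add: in_keys_iff)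
  have weight: "weight m c = weight m (a i)" if "c \<in> Poly_Mapping.keys s" for c
    using d[OF that] d[OF a] by simp
  have "(\<Sum>c\<in>Poly_Mapping.keys s. ?s c) = fibre_sum m s (weight m (a i))"
    unfolding fibre_sum_def by (rule sum.cong) (auto simp: weight)
  then have zero: "(\<Sum>c\<in>Poly_Mapping.keys s. ?s c) = 0"
    using s(1) by (simp add: mem_defining_ideal_iff)
  have "(\<Sum>c\<in>A. Poly_Mapping.single (b i) (?s c)) = Poly_Mapping.single (b i) (\<Sum>c\<in>A. ?s c)" for A
    by (induction A rule: infinite_finite_induct) (auto simp: single_add)
  then have "(\<Sum>c\<in>Poly_Mapping.keys s. Poly_Mapping.single (b i) (?s c)) = 0"
    by (simp add: zero)
  then have "s = (\<Sum>c\<in>Poly_Mapping.keys s. Poly_Mapping.single c (?s c) - Poly_Mapping.single (b i) (?s c))"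
    by (simp add: sum_subtractf sum_single_lookup)
  also have "\<dots> = (\<Sum>c\<in>Poly_Mapping.keys s. Poly_Mapping.single 0 (?s c) *
      (Poly_Mapping.single c 1 - Poly_Mapping.single (b i) 1))"
    by (simp add: algebra_simps mult_single)
  also have "\<dots> = (\<Sum>c\<in>Poly_Mapping.keys s - {a i}. Poly_Mapping.single 0 (?s c) *
      (Poly_Mapping.single c 1 - Poly_Mapping.single (b i) 1)) - Poly_Mapping.single 0 (?s (a i)) * g i"
    by (simp add: sum.remove[OF finite_keys a] g_eq[OF i] algebra_simps)
  finally have eq: "Poly_Mapping.single 0 (?s (a i)) * g i =
      (\<Sum>c\<in>Poly_Mapping.keys s - {a i}. Poly_Mapping.single 0 (?s c) *
      (Poly_Mapping.single c 1 - Poly_Mapping.single (b i) 1)) - s"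
    by (simp add: algebra_simps)
  have "ideal_gen (g ` {j \<in> I. weight m (a j) < weight m (a i)}) \<subseteq> ideal_gen T"
    by (rule ideal_gen_minimal) (use lower in auto)
  then have "Poly_Mapping.single c 1 - Poly_Mapping.single (b i) 1 \<in> ideal_gen T"
    if "c \<in> Poly_Mapping.keys s - {a i}" for c
    using fibre[OF i weight[of c]] that by blast
  then have "Poly_Mapping.single 0 (?s (a i)) * g i \<in> ideal_gen T"
    unfolding eq by (intro ideal_gen_diff[OF ideal_gen_sum sT] ideal_gen_times)
  then have "Poly_Mapping.single 0 (inverse (?s (a i))) * (Poly_Mapping.single 0 (?s (a i)) * g i) \<in> ideal_gen T"
    by (rule ideal_gen_times)
  then show ?thesis
    using nz by (simp add: mult_single flip: mult.assoc)
qed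

text \<open>Choose for each \<open>i\<close> an element of \<open>S\<close> containing
  \<open>a i\<close>. By induction on weight the chosen elements generate every \<open>g i\<close>,
  so minimality makes them all of \<open>S\<close>.\<close>

lemma minimal_homogeneous_generating_set_card:
  fixes S :: "('v, 'k) mpol set"
  assumes "minimal_homogeneous_generating_set m (defining_ideal m) S"
  shows "finite S \<and> card S = card I"
proof -
  from assms have S: "ideal_gen S = defining_ideal m"
    and min: "\<And>T. T \<subset> S \<Longrightarrow> ideal_gen T \<noteq> defining_ideal m"
    and hom: "\<And>p. p \<in> S \<Longrightarrow> homogeneous m p"
    unfolding minimal_homogeneous_generating_set_def minimal_generating_set_def by simp_all
  obtain s where s: "\<And>i. i \<in> I \<Longrightarrow> s i \<in> S \<and> Poly_Mapping.lookup (s i) (a i) \<noteq> 0"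
    using ex_lookup_nonzero[OF _ S] by metis
  have "g i \<in> ideal_gen (s ` I)" if "i \<in> I" for i
    using that
  proof (induction "weight m (a i)" arbitrary: i rule: less_induct)
    case less
    then show ?case
      using s[of i] hom S ideal_gen_base[of _ S]
      by (intro g_mem_of_homogeneous[of i "s i"]) (auto intro: ideal_gen_base)
  qed
  then have "ideal_gen (g ` I) \<subseteq> ideal_gen (s ` I)"
    by (intro ideal_gen_minimal) auto
  moreover have "s ` I \<subseteq> S" using s by auto
  then have "ideal_gen (s ` I) \<subseteq> ideal_gen S"
    by (intro ideal_gen_minimal) (auto intro: ideal_gen_base)
  ultimately have "s ` I = S"
    using min[of "s ` I"] \<open>s ` I \<subseteq> S\<close> S generates by auto
  \<comment> \<open>One homogeneous element cannot contain two of the \<open>a i\<close>, because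
    their weights differ.\<close>
  moreover have "inj_on s I"
  proof (rule inj_onI)
    fix i j assume ij: "i \<in> I" "j \<in> I" "s i = s j"
    then have "a i \<in> Poly_Mapping.keys (s i)" "a j \<in> Poly_Mapping.keys (s i)"
      using s by (metis in_keys_iff)+
    then have "weight m (a i) = weight m (a j)"
      using hom[of "s i"] s[of i] ij by (auto simp: homogeneous_def)
    then show "i = j" using inj_weight ij by (auto dest: inj_onD)
  qed
  ultimately show ?thesis using finite_I card_image by blast
qed

end

subsection \<open>Monomials in four variables\<close>

definition mon :: "nat \<Rightarrow> nat \<Rightarrow> nat \<Rightarrow> nat \<Rightarrow> (var \<Rightarrow>\<^sub>0 nat)" where
  "mon p q r s = Poly_Mapping.single X0 p + Poly_Mapping.single X1 q
     + Poly_Mapping.single X2 r + Poly_Mapping.single X3 s"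

lemma lookup_mon [simp]:
  "Poly_Mapping.lookup (mon p q r s) X0 = p"
  "Poly_Mapping.lookup (mon p q r s) X1 = q"
  "Poly_Mapping.lookup (mon p q r s) X2 = r"
  "Poly_Mapping.lookup (mon p q r s) X3 = s"
  by (simp_all add: mon_def lookup_add lookup_single)

lemma mon_lookup: "mon (Poly_Mapping.lookup e X0) (Poly_Mapping.lookup e X1)
    (Poly_Mapping.lookup e X2) (Poly_Mapping.lookup e X3) = e"
proof (rule poly_mapping_eqI)
  fix i :: var
  show "Poly_Mapping.lookup (mon (Poly_Mapping.lookup e X0) (Poly_Mapping.lookup e X1)
    (Poly_Mapping.lookup e X2) (Poly_Mapping.lookup e X3)) i = Poly_Mapping.lookup e i"
    by (cases i) simp_all
qed

lemma mon_cases: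
  obtains p q r s where "e = mon p q r s"
  using mon_lookup[of e] by metis

lemma mon_eq_iff [simp]: "mon p q r s = mon p' q' r' s' \<longleftrightarrow> p = p' \<and> q = q' \<and> r = r' \<and> s = s'"
  by (metis lookup_mon)

lemma mon_add: "mon p q r s + mon p' q' r' s' = mon (p + p') (q + q') (r + r') (s + s')"
  by (simp add: mon_def single_add algebra_simps)

lemma keys_mon:
  "Poly_Mapping.keys (mon p q r s) =
     (if p = 0 then {} else {X0}) \<union> (if q = 0 then {} else {X1})
     \<union> (if r = 0 then {} else {X2}) \<union> (if s = 0 then {} else {X3})"
proof -
  have "i \<in> Poly_Mapping.keys (mon p q r s) \<longleftrightarrow> i \<in> (if p = 0 then {} else {X0}) \<union> (if q = 0 then {} else {X1})
     \<union> (if r = 0 then {} else {X2}) \<union> (if s = 0 then {} else {X3})" for i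
    by (cases i) (simp_all add: in_keys_iff)
  then show ?thesis by blast
qed

lemma Var_power: "Var i ^ k = Poly_Mapping.single (Poly_Mapping.single i k) 1"
  by (induction k) (simp_all add: Var_def mult_single flip: single_add)

lemma single_mon: "Poly_Mapping.single (mon p q r s) 1 = x0 ^ p * x1 ^ q * x2 ^ r * x3 ^ s"
  by (simp add: Var_power mult_single mon_def)

text \<open>The weights of the variables exceed n(n+2) by 0, 1, n+1 and n+2. The second summand is
  the surplus over degree times n(n+2), with base n+1 digits \<open>q + s\<close> and
  \<open>r + s\<close> when these are small.\<close>

lemma weight_mon:
  "weight (gen4 n) (mon p q r s) = (p + q + r + s) * (n * (n + 2)) + ((q + s) + (n + 1) * (r + s))"
  by (simp add: weight_def UNIV_var power2_eq_square algebra_simps)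

lemma digits_unique:
  fixes n :: nat
  assumes "B + (n + 1) * C = B' + (n + 1) * C'" "B \<le> n" "B' \<le> n"
  shows "B = B'" "C = C'"
proof -
  have "(B + (n + 1) * C) mod (n + 1) = B" "(B' + (n + 1) * C') mod (n + 1) = B'"
    using assms(2,3) by (simp_all only: mod_mult_self2) simp_all
  then show "B = B'" using assms(1) by simp
  then have "(n + 1) * C = (n + 1) * C'" using assms(1) by (simp only: add_left_cancel)
  then show "C = C'" by (simp only: mult_cancel1) simp
qed

text \<open>Up to degree n the surplus is at most n(n+2), the cost of one degree. With
  \<open>weight_mon_ge\<close> this leaves at most two degrees in each fibre studied below.\<close>

lemma weight_mon_le:
  assumes "p + q + r + s = D" "D \<le> n"
  shows "weight (gen4 n) (mon p q r s) \<le> (D + 1) * (n * (n + 2))"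
proof -
  have "(q + s) + (n + 1) * (r + s) \<le> D + (n + 1) * D"
    using assms(1) by (intro add_mono mult_left_mono) auto
  also have "\<dots> = D * (n + 2)" by (simp add: algebra_simps)
  also have "\<dots> \<le> n * (n + 2)" using assms(2) by (rule mult_right_mono) simp
  finally show ?thesis using assms(1) by (simp add: weight_mon)
qed

lemma weight_mon_ge: "(p + q + r + s) * (n * (n + 2)) \<le> weight (gen4 n) (mon p q r s)"
  by (simp add: weight_mon)

text \<open>Each generator is oriented as target minus source so that the source is isolated in its fibre.\<close>

datatype gen_index = Cross nat | Edge nat | Power | Quadric

definition gen_indices :: "nat \<Rightarrow> gen_index set" where
  "gen_indices n = Cross ` {1..n-1} \<union> Edge ` {..n} \<union> {Power, Quadric}"

fun source :: "nat \<Rightarrow> gen_index \<Rightarrow> (var \<Rightarrow>\<^sub>0 nat)" where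
  "source n (Cross \<mu>) = mon (n + 1 - \<mu>) (\<mu> + 1) 0 0"
| "source n (Edge t) = mon (n - t) 0 (t + 1) 0"
| "source n Power = mon 0 0 0 n"
| "source n Quadric = mon 1 0 0 1"

fun target :: "nat \<Rightarrow> gen_index \<Rightarrow> (var \<Rightarrow>\<^sub>0 nat)" where
  "target n (Cross \<mu>) = mon 0 0 (n + 1 - \<mu>) \<mu>"
| "target n (Edge t) = mon 0 (n + 1 - t) 0 t"
| "target n Power = mon (n + 1) 0 0 0"
| "target n Quadric = mon 0 1 1 0"

definition generator :: "nat \<Rightarrow> gen_index \<Rightarrow> (var, 'k::field) mpol" where
  "generator n i = Poly_Mapping.single (target n i) 1 - Poly_Mapping.single (source n i) 1"

lemma generator_image:
  "(generator n :: _ \<Rightarrow> (var, 'k::field) mpol) ` gen_indices n = A1' n \<union> A2 n \<union> {g1 n, g2}"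
proof -
  let ?g = "generator n :: _ \<Rightarrow> (var, 'k) mpol"
  have "?g ` Cross ` {1..n-1} = A1' n"
    unfolding A1'_def by (auto simp: image_image generator_def single_mon image_iff)
  moreover have "?g ` Edge ` {..n} = A2 n"
    unfolding A2_def by (auto simp: image_image generator_def single_mon image_iff)
  moreover have "?g Power = g1 n" "?g Quadric = g2"
    by (simp_all add: generator_def single_mon g1_def g2_def)
  ultimately show ?thesis
    by (simp only: gen_indices_def image_Un image_insert image_empty)
qed

lemma finite_gen_indices: "finite (gen_indices n)"
  by (simp add: gen_indices_def)

lemma card_gen_indices:
  assumes "n \<ge> 1"
  shows "card (gen_indices n) = 2 * (n + 1)"
proof -
  have "card (Cross ` {1..n-1} \<union> Edge ` {..n}) = (n - 1) + (n + 1)"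
    by (subst card_Un_disjoint) (auto simp: card_image inj_on_def)
  moreover have "card (gen_indices n) = card (Cross ` {1..n-1} \<union> Edge ` {..n}) + 2"
    unfolding gen_indices_def by (subst card_Un_disjoint) auto
  ultimately show ?thesis using assms by simp
qed

lemma weight_source:
  "\<mu> \<le> n \<Longrightarrow> weight (gen4 n) (source n (Cross \<mu>)) = (n + 2) * (n * (n + 2)) + (\<mu> + 1)"
  "t \<le> n \<Longrightarrow> weight (gen4 n) (source n (Edge t)) = (n + 1) * (n * (n + 2)) + (n + 1) * (t + 1)"
  "weight (gen4 n) (source n Power) = (n + 1) * (n * (n + 2))"
  "weight (gen4 n) (source n Quadric) = 2 * (n * (n + 2)) + (n + 2)"
  by (simp_all add: weight_mon algebra_simps)

lemma weight_target:
  assumes "i \<in> gen_indices n"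
  shows "weight (gen4 n) (target n i) = weight (gen4 n) (source n i)"
proof (cases i)
  case (Cross \<mu>)
  then have "\<mu> \<le> n" using assms by (auto simp: gen_indices_def)
  then obtain k where "n = \<mu> + k" by (auto dest: le_Suc_ex)
  then show ?thesis using Cross by (simp add: weight_mon algebra_simps)
next
  case (Edge t)
  then have "t \<le> n" using assms by (auto simp: gen_indices_def)
  then obtain k where "n = t + k" by (auto dest: le_Suc_ex)
  then show ?thesis using Edge by (simp add: weight_mon algebra_simps)
qed (simp_all add: weight_mon algebra_simps)

subsection \<open>The fibres of the generators\<close>

text \<open>The surplus n+2 is positive and below n(n+2), which forces degree 2. Then both digits
  are 1.\<close>

lemma fibre_Quadric:
  assumes "n \<ge> 3" and w: "weight (gen4 n) (mon p q r s) = weight (gen4 n) (source n Quadric)"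
  shows "mon p q r s \<in> {source n Quadric, target n Quadric}"
proof -
  let ?m = "n * (n + 2)"
  have "n + 2 < 3 * (n + 2)" by simp
  also have "\<dots> \<le> ?m" using assms(1) by (rule mult_right_mono) simp
  finally have m: "n + 2 < ?m" .
  have "p + q + r + s = 2"
  proof (rule antisym)
    have "(p + q + r + s) * ?m < 3 * ?m"
      using w m weight_mon_ge[of p q r s n] by (simp only: weight_source)
    then have "p + q + r + s < 3" by (rule mult_right_less_imp_less) simp
    then show "p + q + r + s \<le> 2" by simp
    show "2 \<le> p + q + r + s"
    proof (rule ccontr)
      assume "\<not> 2 \<le> p + q + r + s"
      then have "(p + q + r + s + 1) * ?m \<le> 2 * ?m"
        by (intro mult_right_mono) auto
      moreover have "weight (gen4 n) (mon p q r s) \<le> (p + q + r + s + 1) * ?m"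
        using \<open>\<not> 2 \<le> p + q + r + s\<close> assms(1) by (intro weight_mon_le[OF refl]) simp
      moreover have "weight (gen4 n) (mon p q r s) = 2 * ?m + (n + 2)"
        using w by (simp only: weight_source)
      ultimately show False by linarith
    qed
  qed
  with w have eq: "(q + s) + (n + 1) * (r + s) = 1 + (n + 1) * 1"
    by (simp only: weight_source weight_mon) simp
  from digits_unique[OF this] \<open>p + q + r + s = 2\<close> assms(1)
  have "q + s = 1" "r + s = 1" by auto
  with \<open>p + q + r + s = 2\<close> show ?thesis by auto
qed

text \<open>Degree n+1 leaves surplus 0; degree n leaves n(n+2) = n + (n+1)n, whose digits are both
  n. Lower degrees are too light.\<close>

lemma fibre_Power:
  assumes "n \<ge> 1" and w: "weight (gen4 n) (mon p q r s) = weight (gen4 n) (source n Power)"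
  shows "mon p q r s \<in> {source n Power, target n Power}"
proof -
  let ?m = "n * (n + 2)" and ?D = "p + q + r + s"
  have "?D * ?m \<le> (n + 1) * ?m"
    using w weight_mon_ge[of p q r s n] by (simp only: weight_source)
  then have D: "?D \<le> n + 1" by (rule mult_right_le_imp_le) (use assms(1) in simp)
  show ?thesis
  proof (cases "?D = n + 1")
    case True
    with w have "(q + s) + (n + 1) * (r + s) = 0"
      by (simp only: weight_source weight_mon)
    then have "q = 0" "r = 0" "s = 0" by simp_all
    with True show ?thesis by simp
  next
    case False
    then have "?D \<le> n" using D by simp
    then have "(n + 1) * ?m \<le> (?D + 1) * ?m"
      using weight_mon_le[OF refl, of p q r s n] w by (simp only: weight_source)
    then have "n + 1 \<le> ?D + 1" by (rule mult_right_le_imp_le) (use assms(1) in simp)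
    with \<open>?D \<le> n\<close> have D: "?D = n" by simp
    with w have "(q + s) + (n + 1) * (r + s) = ?m"
      by (simp only: weight_source weight_mon) simp
    also have "?m = n + (n + 1) * n" by (simp add: algebra_simps)
    finally have "q + s = n" "r + s = n"
      using digits_unique[of "q + s" n "r + s" n n] D by auto
    with D show ?thesis by simp
  qed
qed

text \<open>The surplus (n+1)(t+1) is at most (n+1)^2 = n(n+2) + 1. So degree n+2 is possible only
  for t = n, where the remaining surplus 1 gives a third monomial.\<close>

lemma fibre_Edge:
  assumes "n \<ge> 1" "t \<le> n" and w: "weight (gen4 n) (mon p q r s) = weight (gen4 n) (source n (Edge t))"
  shows "mon p q r s \<in> {source n (Edge t), target n (Edge t)} \<or> t = n \<and> mon p q r s = mon (n + 1) 1 0 0"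
proof -
  let ?m = "n * (n + 2)" and ?D = "p + q + r + s"
  have m: "(n + 1) * (n + 1) = ?m + 1" by (simp add: algebra_simps)
  have m3: "?m \<ge> 3" using assms(1) mult_le_mono[of 1 n 3 "n + 2"] by simp
  have t: "(n + 1) * (t + 1) \<le> ?m + 1"
    using assms(2) unfolding m[symmetric] by (intro mult_left_mono) auto
  have "?D * ?m < (n + 3) * ?m"
    using w t m3 weight_mon_ge[of p q r s n] assms(2)
    by (simp only: weight_source) (simp add: algebra_simps)
  then have "?D < n + 3" by simp
  moreover have "n + 1 \<le> ?D"
  proof (rule ccontr)
    assume "\<not> n + 1 \<le> ?D"
    then have "(?D + 1) * ?m \<le> (n + 1) * ?m" by (intro mult_right_mono) auto
    moreover have "weight (gen4 n) (mon p q r s) = (n + 1) * ?m + (n + 1) * (t + 1)"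
      using w assms(2) by (simp only: weight_source)
    moreover have "weight (gen4 n) (mon p q r s) \<le> (?D + 1) * ?m"
      using \<open>\<not> n + 1 \<le> ?D\<close> by (intro weight_mon_le[OF refl]) simp
    moreover have "(n + 1) * (t + 1) > 0" by simp
    ultimately show False by linarith
  qed
  ultimately consider "?D = n + 2" | "?D = n + 1" by linarith
  then show ?thesis
  proof cases
    case 1
    then have "(n + 2) * ?m + ((q + s) + (n + 1) * (r + s)) = (n + 1) * ?m + (n + 1) * (t + 1)"
      using w assms(2) by (simp only: weight_source weight_mon)
    then have eq: "?m + ((q + s) + (n + 1) * (r + s)) = (n + 1) * (t + 1)"
      by (simp add: algebra_simps)
    then have le: "(q + s) + (n + 1) * (r + s) \<le> 1" using t by linarith
    have "r + s = 0"
    proof (rule ccontr)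
      assume "r + s \<noteq> 0"
      then have "(n + 1) * 1 \<le> (n + 1) * (r + s)" by (intro mult_left_mono) auto
      also have "\<dots> \<le> (q + s) + (n + 1) * (r + s)" by (rule le_add2)
      also note le
      finally show False using assms(1) by simp
    qed
    have "t = n"
    proof (rule ccontr)
      assume "t \<noteq> n"
      then have "(n + 1) * (t + 1) \<le> (n + 1) * n" using assms(2) by (intro mult_left_mono) auto
      also have "\<dots> < ?m" using assms(1) by simp
      finally show False using eq by linarith
    qed
    with eq m \<open>r + s = 0\<close> have "q + s = 1" by simp
    with \<open>r + s = 0\<close> 1 \<open>t = n\<close> show ?thesis by auto
  next
    case 2
    then have eq: "(q + s) + (n + 1) * (r + s) = 0 + (n + 1) * (t + 1)"
      using w assms(2) by (simp only: weight_source weight_mon)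
    show ?thesis
    \<comment> \<open>In degree n+1 the digit \<open>q + s\<close> may reach n+1, one beyond the
      range of \<open>digits_unique\<close>; this carry yields the target.\<close>
    proof (cases "q + s = n + 1")
      case True
      then have "(n + 1) * (r + s + 1) = (n + 1) * (t + 1)" using eq by simp
      then have "r + s + 1 = t + 1" by (simp only: mult_cancel1) simp
      then show ?thesis using True 2 assms(2) by auto
    next
      case False
      then have "q + s = 0" "r + s = t + 1"
        using digits_unique[OF eq] 2 by auto
      then show ?thesis using 2 by auto
    qed
  qed
qed

text \<open>Only degrees n+1 and n+2 fit the weight; the lower one admits just the target, the
  higher one just the source.\<close>

lemma fibre_Cross:
  assumes "n \<ge> 1" "1 \<le> \<mu>" "\<mu> < n"
    and w: "weight (gen4 n) (mon p q r s) = weight (gen4 n) (source n (Cross \<mu>))"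
  shows "mon p q r s \<in> {source n (Cross \<mu>), target n (Cross \<mu>)}"
proof -
  let ?m = "n * (n + 2)" and ?D = "p + q + r + s"
  have m: "(n + 1) * (n + 1) = ?m + 1" by (simp add: algebra_simps)
  have mn: "n + 2 \<le> ?m" using assms(1) mult_right_mono[of 1 n "n + 2"] by simp
  have ws: "weight (gen4 n) (source n (Cross \<mu>)) = (n + 2) * ?m + (\<mu> + 1)"
    using assms(3) by (intro weight_source) simp
  have "?D * ?m < (n + 3) * ?m"
    using w ws mn weight_mon_ge[of p q r s n] assms(3)
    by (simp add: algebra_simps)
  then have "?D < n + 3" by simp
  moreover have "n + 1 \<le> ?D"
  proof (rule ccontr)
    assume "\<not> n + 1 \<le> ?D"
    then have "(?D + 1) * ?m \<le> (n + 2) * ?m" by (intro mult_right_mono) auto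
    then show False
      using weight_mon_le[OF refl, of p q r s n] \<open>\<not> n + 1 \<le> ?D\<close> w ws by linarith
  qed
  ultimately consider "?D = n + 2" | "?D = n + 1" by linarith
  then show ?thesis
  proof cases
    case 1
    then have eq: "(q + s) + (n + 1) * (r + s) = (\<mu> + 1) + (n + 1) * 0"
      using w ws by (simp only: weight_mon)
    have "r + s = 0"
    proof (rule ccontr)
      assume "r + s \<noteq> 0"
      then have "(n + 1) * 1 \<le> (n + 1) * (r + s)" by (intro mult_left_mono) auto
      also have "\<dots> \<le> (q + s) + (n + 1) * (r + s)" by (rule le_add2)
      also note eq
      finally show False using assms(3) by simp
    qed
    then have "q + s = \<mu> + 1" using eq by simp
    then show ?thesis using \<open>r + s = 0\<close> 1 by auto
  next
    case 2
    then have "(n + 1) * ?m + ((q + s) + (n + 1) * (r + s)) = (n + 2) * ?m + (\<mu> + 1)"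
      using w ws by (simp only: weight_mon)
    then have eq: "(q + s) + (n + 1) * (r + s) = \<mu> + (n + 1) * (n + 1)"
      by (simp add: algebra_simps)
    \<comment> \<open>A smaller \<open>r + s\<close> would need \<open>q + s\<close> at least \<mu>
      + n + 1, more than the degree as \<mu> is positive. For \<mu> = 0 the monomial
      \<open>x1 * x3^n\<close> would survive here.\<close>
    have "r + s = n + 1"
    proof (rule ccontr)
      assume "r + s \<noteq> n + 1"
      then have "(n + 1) * (r + s) \<le> (n + 1) * n" using 2 by (intro mult_left_mono) auto
      moreover have "(n + 1) * (n + 1) = (n + 1) * n + (n + 1)" by simp
      ultimately have "q + s \<ge> \<mu> + (n + 1)" using eq by linarith
      then show False using 2 assms(2) by linarith
    qed
    then have "q + s = \<mu>" using eq by simp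
    then show ?thesis using \<open>r + s = n + 1\<close> 2 by auto
  qed
qed

lemma fibre_source:
  assumes "n \<ge> 3" "i \<in> gen_indices n" "weight (gen4 n) c = weight (gen4 n) (source n i)"
  shows "c = source n i \<or> c = target n i \<or> i = Edge n \<and> c = mon (n + 1) 1 0 0"
proof -
  obtain p q r s where c: "c = mon p q r s" by (rule mon_cases)
  have n: "1 \<le> n" using assms(1) by simp
  show ?thesis
  proof (cases i)
    case (Cross \<mu>)
    then have "1 \<le> \<mu>" "\<mu> < n" using assms(2) by (auto simp: gen_indices_def)
    then show ?thesis using fibre_Cross[OF n, of \<mu> p q r s] assms(3) Cross unfolding c by blast
  next
    case (Edge t)
    then have "t \<le> n" using assms(2) by (auto simp: gen_indices_def)
    then show ?thesis using fibre_Edge[OF n, of t p q r s] assms(3) Edge unfolding c by auto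
  next
    case Power
    then show ?thesis using fibre_Power[OF n, of p q r s] assms(3) unfolding c by auto
  next
    case Quadric
    then show ?thesis using fibre_Quadric[of n p q r s] assms(1,3) unfolding c by auto
  qed
qed

text \<open>The orientation matters at \<open>Edge n\<close>: its target \<open>x1 * x3^n\<close>
  shares \<open>x1\<close> with the third monomial of the fibre, whereas \<open>x2^(n+1)\<close>
  meets neither.\<close>

lemma isolated_source:
  assumes "n \<ge> 3" "i \<in> gen_indices n"
  shows "isolated (gen4 n) (source n i)"
  unfolding isolated_def
proof (intro allI impI)
  fix c assume "weight (gen4 n) c = weight (gen4 n) (source n i)" "c \<noteq> source n i"
  then have "c = target n i \<or> i = Edge n \<and> c = mon (n + 1) 1 0 0"
    using fibre_source[OF assms] by blast
  then show "Poly_Mapping.keys c \<inter> Poly_Mapping.keys (source n i) = {}"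
    using assms(2) by (cases i) (auto simp: keys_mon gen_indices_def split: if_splits)
qed

lemma source_neq_target: "n \<ge> 1 \<Longrightarrow> source n i \<noteq> target n i"
  by (cases i) auto

lemma inj_weight_source:
  assumes "n \<ge> 3"
  shows "inj_on (\<lambda>i. weight (gen4 n) (source n i)) (gen_indices n)"
proof (rule inj_onI)
  fix i j
  assume ij: "i \<in> gen_indices n" "j \<in> gen_indices n"
    and w: "weight (gen4 n) (source n i) = weight (gen4 n) (source n j)"
  from fibre_source[OF assms ij(1) w[symmetric]] fibre_source[OF assms ij(2) w] assms ij
  show "i = j"
    by (cases i; cases j) (auto simp: gen_indices_def)
qed

subsection \<open>Generation\<close>

context
  fixes n :: nat and J :: "(var, 'k::field) mpol set"
  assumes n: "n \<ge> 3"
  defines "J \<equiv> ideal_gen (generator n ` gen_indices n)"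
begin

lemma generator_shift:
  assumes "i \<in> gen_indices n"
  shows "Poly_Mapping.single (e + target n i) 1 - Poly_Mapping.single (e + source n i) 1 \<in> J"
proof -
  have "Poly_Mapping.single (e + target n i) 1 - Poly_Mapping.single (e + source n i) 1 =
      Poly_Mapping.single e 1 * generator n i"
    by (simp add: generator_def mult_single algebra_simps)
  also have "\<dots> \<in> J"
    unfolding J_def using assms by (intro ideal_gen_times ideal_gen_base) simp
  finally show ?thesis .
qed

text \<open>For \<open>\<mu> = 0\<close> the binomial is not among the generators, but it equals minus the sum of
  \<open>Edge n\<close> and \<open>x1\<close> times \<open>Power\<close>.\<close>

lemma cross_shift:
  assumes "\<mu> < n"
  shows "Poly_Mapping.single (e + target n (Cross \<mu>)) 1 - Poly_Mapping.single (e + source n (Cross \<mu>)) 1 \<in> J"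
proof (cases "\<mu> = 0")
  case False
  then show ?thesis
    using assms by (intro generator_shift) (auto simp: gen_indices_def)
next
  case True
  have "Poly_Mapping.single (e + target n (Cross \<mu>)) 1 - Poly_Mapping.single (e + source n (Cross \<mu>)) 1 =
    - 1 * (Poly_Mapping.single (e + target n (Edge n)) 1 - Poly_Mapping.single (e + source n (Edge n)) (1::'k))
    - (Poly_Mapping.single (e + mon 0 1 0 0 + target n Power) 1
       - Poly_Mapping.single (e + mon 0 1 0 0 + source n Power) 1)"
    using True by (simp add: add.assoc mon_add)
  also have "\<dots> \<in> J"
    using generator_shift[of "Edge n" e] generator_shift[of Power "e + mon 0 1 0 0"]
    unfolding J_def by (intro ideal_gen_diff[OF ideal_gen_times]) (auto simp: gen_indices_def)
  finally show ?thesis .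
qed

text \<open>The monomials divisible by no left-hand side of the rewriting rules:
  \<open>x3^n\<close>, \<open>x1 * x2\<close> and the targets of \<open>Edge\<close> and
  \<open>Cross\<close>, the latter including \<mu> = 0.\<close>

definition reduced :: "nat \<Rightarrow> nat \<Rightarrow> nat \<Rightarrow> nat \<Rightarrow> bool" where
  "reduced p q r s \<longleftrightarrow> s < n \<and> q + s \<le> n \<and> r + s \<le> n \<and> (q = 0 \<or> r = 0)"

text \<open>Every rewriting step below lowers the total degree in \<open>x1\<close>, \<open>x2\<close>, \<open>x3\<close>.\<close>

lemma reduce:
  "\<exists>p' q' r' s'. reduced p' q' r' s'
     \<and> Poly_Mapping.single (mon p q r s) 1 - Poly_Mapping.single (mon p' q' r' s') 1 \<in> J"
proof (induction "q + r + s" arbitrary: p q r s rule: less_induct)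
  case less
  have step: ?case
    if "u + v + w < q + r + s"
      "Poly_Mapping.single (mon p q r s) 1 - Poly_Mapping.single (mon t u v w) 1 \<in> J" for t u v w
  proof -
    from less[OF that(1)] obtain p' q' r' s' where red: "reduced p' q' r' s'"
      and "Poly_Mapping.single (mon t u v w) 1 - Poly_Mapping.single (mon p' q' r' s') 1 \<in> J" by blast
    from ideal_gen_add[OF that(2)[unfolded J_def] this(2)[unfolded J_def]] red
    show ?thesis by (auto simp: J_def)
  qed
  \<comment> \<open>\<open>Power\<close> is used from source to target, unlike the other rules, so
    its difference has the opposite sign.\<close>
  have neg: "x - y \<in> J \<Longrightarrow> y - x \<in> J" for x y
    using ideal_gen_times[of "x - y" _ "- 1"] by (simp add: J_def)
  consider "s \<ge> n" | "q \<ge> 1" "r \<ge> 1" | "s < n" "q + s \<ge> n + 1" | "s < n" "r + s \<ge> n + 1"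
    | "reduced p q r s"
    unfolding reduced_def by linarith
  then show ?case
  proof cases
    case 1
    then obtain k where "s = n + k" using le_Suc_ex by blast
    with neg[OF generator_shift[of Power "mon p q r k"]] n show ?thesis
      by (intro step[of q r k "p + n + 1"]) (simp_all add: mon_add gen_indices_def add.commute)
  next
    case 2
    then obtain k l where "q = k + 1" "r = l + 1" by (metis add.commute le_Suc_ex)
    with generator_shift[of Quadric "mon p k l s"] show ?thesis
      by (intro step[of k l "s + 1" "p + 1"]) (simp_all add: mon_add gen_indices_def)
  next
    case 3
    then obtain k where "q = k + (n + 1 - s)"
      by (metis add.commute diff_le_mono2 le_Suc_ex le_add1 le_add_diff_inverse2 le_diff_conv)
    \<comment> \<open>The measure falls from k + r + n + 1 to k + r + s + 1, strictly because s <
      n.\<close>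
    with 3 generator_shift[of "Edge s" "mon p k r 0"] show ?thesis
      by (intro step[of k "r + s + 1" 0 "p + (n - s)"]) (simp_all add: mon_add gen_indices_def)
  next
    case 4
    then obtain k where "r = k + (n + 1 - s)"
      by (metis add.commute diff_le_mono2 le_Suc_ex le_add1 le_add_diff_inverse2 le_diff_conv)
    with 4 cross_shift[of s "mon p q k 0"] show ?thesis
      by (intro step[of "q + s + 1" k 0 "p + (n + 1 - s)"]) (simp_all add: mon_add)
  next
    case 5
    then show ?thesis
      by (intro exI[of _ p] exI[of _ q] exI[of _ r] exI[of _ s])
        (simp add: J_def ideal_gen_def ideal.span_zero)
  qed
qed

lemma reduced_unique:
  assumes red: "reduced p q r s" "reduced p' q' r' s'"
    and w: "weight (gen4 n) (mon p q r s) = weight (gen4 n) (mon p' q' r' s')"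
  shows "mon p q r s = mon p' q' r' s'"
proof -
  have lt: "(q + s) + (n + 1) * (r + s) < n * (n + 2)" if "reduced p q r s" for p q r s
  proof -
    \<comment> \<open>If r + s = n, then r is positive since s < n, so q = 0 and q + s < n. This
      excludes the surplus n + (n+1)n = n(n+2).\<close>
    have le: "q + s \<le> n" "r + s \<le> n" and ne: "r + s = n \<Longrightarrow> q + s < n"
      using that by (auto simp: reduced_def)
    show ?thesis
    proof (cases "r + s = n")
      case True
      then show ?thesis using ne by (simp add: algebra_simps)
    next
      case False
      then have "(n + 1) * (r + s + 1) \<le> (n + 1) * n"
        using le(2) by (intro mult_left_mono) auto
      then show ?thesis using le(1) n by (simp add: algebra_simps)
    qed
  qed
  have div: "weight (gen4 n) (mon p q r s) div (n * (n + 2)) = p + q + r + s" if "reduced p q r s" for p q r s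
    using lt[OF that] n unfolding weight_mon by (subst div_mult_self3) simp_all
  have D: "p + q + r + s = p' + q' + r' + s'"
    using div[OF red(1)] div[OF red(2)] w by simp
  then have "(q + s) + (n + 1) * (r + s) = (q' + s') + (n + 1) * (r' + s')"
    using w unfolding weight_mon by simp
  from digits_unique[OF this] red have "q + s = q' + s'" "r + s = r' + s'"
    by (simp_all add: reduced_def)
  \<comment> \<open>The digits fix q - r, and as one of q and r is zero this fixes both.\<close>
  with D red show ?thesis by (auto simp: reduced_def)
qed

lemma defining_ideal_gen4: "J = defining_ideal (gen4 n)"
proof
  have "generator n i \<in> defining_ideal (gen4 n)" if "i \<in> gen_indices n" for i
    unfolding generator_def by (rule binomial_mem_defining_ideal) (simp add: weight_target that)
  then show sub: "J \<subseteq> defining_ideal (gen4 n)"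
    unfolding J_def by (intro ideal_gen_subset_defining_ideal) auto
  \<comment> \<open>Fibre sums of elements of the ideal vanish, so passing to a reduced monomial
    preserves weight.\<close>
  have weight_eq: "weight (gen4 n) a = weight (gen4 n) b"
    if "Poly_Mapping.single a 1 - Poly_Mapping.single b 1 \<in> J" for a b
  proof -
    have "fibre_sum (gen4 n) (Poly_Mapping.single a 1 + Poly_Mapping.single b (- 1 :: 'k)) (weight (gen4 n) a) = 0"
      using that sub by (auto simp: mem_defining_ideal_iff single_uminus)
    then show ?thesis by (simp add: fibre_sum_add fibre_sum_single split: if_splits)
  qed
  show "defining_ideal (gen4 n) \<subseteq> J"
    unfolding J_def
  proof (rule defining_ideal_subset)
    fix a b :: "var \<Rightarrow>\<^sub>0 nat"
    assume w: "weight (gen4 n) a = weight (gen4 n) b"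
    have "\<exists>p q r s. reduced p q r s \<and> Poly_Mapping.single e 1 - Poly_Mapping.single (mon p q r s) 1 \<in> J" for e
      by (rule mon_cases[of e]) (use reduce in blast)
    then obtain p q r s p' q' r' s' where red: "reduced p q r s" "reduced p' q' r' s'"
      and a: "Poly_Mapping.single a 1 - Poly_Mapping.single (mon p q r s) 1 \<in> J"
      and b: "Poly_Mapping.single b 1 - Poly_Mapping.single (mon p' q' r' s') 1 \<in> J"
      by metis
    have "mon p q r s = mon p' q' r' s'"
      using reduced_unique[OF red] weight_eq[OF a] weight_eq[OF b] w by simp
    with ideal_gen_diff[OF a[unfolded J_def] b[unfolded J_def]]
    show "Poly_Mapping.single a 1 - Poly_Mapping.single b 1
        \<in> ideal_gen (generator n ` gen_indices n :: (var, 'k) mpol set)"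
      by simp
  qed
qed

end

section \<open>The listed binomials as indispensable generators\<close>

lemma indispensable_generators_gen4:
  assumes "n \<ge> 3"
  shows "indispensable_generators (gen4 n) (gen_indices n) (source n) (target n)
    (generator n :: _ \<Rightarrow> (var, 'k::field) mpol)"
proof
  show "finite (gen_indices n)" by (rule finite_gen_indices)
  show "inj_on (\<lambda>i. weight (gen4 n) (source n i)) (gen_indices n)"
    by (rule inj_weight_source[OF assms])
  show "ideal_gen (generator n ` gen_indices n :: (var, 'k) mpol set) = defining_ideal (gen4 n)"
    by (rule defining_ideal_gen4[OF assms])
  fix i assume i: "i \<in> gen_indices n"
  show "generator n i = (Poly_Mapping.single (target n i) 1 - Poly_Mapping.single (source n i) 1 :: (var, 'k) mpol)"
    by (rule generator_def)
  show "source n i \<noteq> target n i" using assms by (intro source_neq_target) simp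
  show "weight (gen4 n) (target n i) = weight (gen4 n) (source n i)" by (rule weight_target[OF i])
  show "isolated (gen4 n) (source n i)" by (rule isolated_source[OF assms i])
  fix c assume c: "weight (gen4 n) c = weight (gen4 n) (source n i)" "c \<noteq> source n i"
  let ?L = "generator n ` {j \<in> gen_indices n. weight (gen4 n) (source n j) < weight (gen4 n) (source n i)}
    :: (var, 'k) mpol set"
  from fibre_source[OF assms i c(1)] c(2)
  consider "c = target n i" | "i = Edge n" "c = mon (n + 1) 1 0 0" by blast
  then show "Poly_Mapping.single c 1 - Poly_Mapping.single (target n i) 1 \<in> ideal_gen ?L"
  proof cases
    case 1
    then show ?thesis by (simp add: ideal_gen_def ideal.span_zero)
  next
    case 2
    \<comment> \<open>The third monomial and the target of \<open>Edge n\<close> differ by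
      \<open>x1\<close> times \<open>Power\<close>, a generator of smaller weight.\<close>
    then have "Poly_Mapping.single c 1 - Poly_Mapping.single (target n i) 1 =
        Poly_Mapping.single (mon 0 1 0 0) 1 * (generator n Power :: (var, 'k) mpol)"
      by (simp add: generator_def right_diff_distrib mult_single mon_add)
    also have "weight (gen4 n) (source n Power) < weight (gen4 n) (source n (Edge n))"
      by (simp only: weight_source) simp
    then have "Poly_Mapping.single (mon 0 1 0 0) 1 * generator n Power \<in> ideal_gen ?L"
      using 2 by (intro ideal_gen_times ideal_gen_base) (auto simp: gen_indices_def)
    finally show ?thesis .
  qed
qed

theorem theorem3p5:
  fixes n :: nat
  assumes "n \<ge> 5"
  shows "minimal_generating_set (Q4 n :: (var, 'k::field) mpol set)
           (A1' n \<union> A2 n \<union> {g1 n, g2})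
         \<and> min_num_generators (Q4 n :: (var, 'k) mpol set) = 2 * (n + 1)
         \<and> (\<forall>S :: (var, 'k) mpol set.
               minimal_homogeneous_generating_set (gen4 n) (Q4 n) S
                 \<longrightarrow> finite S \<and> card S = 2 * (n + 1))"
proof -
  interpret indispensable_generators "gen4 n" "gen_indices n" "source n" "target n"
    "generator n :: _ \<Rightarrow> (var, 'k) mpol"
    using assms by (intro indispensable_generators_gen4) simp
  have "card (gen_indices n) = 2 * (n + 1)"
    using assms by (intro card_gen_indices) simp
  then show ?thesis
    using minimal_generating_set_g min_num_generators_eq minimal_homogeneous_generating_set_card
    by (simp add: Q4_def generator_image)
qed

end
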